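(* Let $G=(G_\ell)_{\ell\in\mathbb{N}}$ be a greedy numeration system that meets the following two conditions: (i) the dynamical system $(\mathcal{K}_G,\tau_G)$ is uniquely ergodic; (ii) $\displaystyle\sum_{k=0}^{+\infty}\frac{k}{G_k}$ is bounded (i.e. the series converges). Then the carry propagation $$\mathsf{CP}_G=\lim_{N\to\infty}\frac1N\sum_{i=0}^{N-1}\mathsf{cp}_G\big(\tau_G^{\,i}(0)\big)$$ exists.
   Context: A greedy numeration system (GNS) is given by a basis $G=(G_\ell)_{\ell\in\mathbb{N}}$, a strictly increasing sequence of integers with $G_0=1$; throughout, the sequence of quotients $G_{\ell+1}/G_\ell$ is assumed bounded. The greedy $G$-expansion of an integer $N\geq1$: let $k$ be such that $G_k\le N<G_{k+1}$; let $x_k$ and $r_k$ be the quotient and remainder of the Euclidean division of $N$ by $G_k$; for $i=k-1,\ldots,0$ let $x_i$ and $r_i$ be the quotient and remainder of the division of $r_{i+1}$ by $G_i$. Then $\langle N\rangle_G=x_kx_{k-1}\cdots x_0$; also $\langle 0\rangle_G=\varepsilon$. The digits lie in a finite alphabet $A$ of consecutive integers starting at $0$. Let $L_G=\{\langle N\rangle_G: N\in\mathbb{N}\}$. Let ${}^{\omega}A$ be the set of left infinite words $s=\cdots s_2s_1s_0$ over $A$, with the product topology (compact), and for a finite word $w$ let ${}^{\omega}0\,w$ be the left infinite word ending in $w$ preceded by zeros. Write $s_{[j,0]}=s_js_{j-1}\cdots s_0$. The compactification is $\mathcal{K}_G=\{s\in{}^{\omega}A: \forall j\in\mathbb{N},\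 s_{[j,0]}\in0^*L_G\}$, the closure of ${}^\omega0L_G$. The odometer $\tau_G:\mathcal{K}_G\to\mathcal{K}_G$ is defined by $\tau_G(s)=\lim_{j\to\infty}{}^{\omega}0\,\langle n_j+1\rangle_G$, where $n_j=\sum_{i=0}^{j}s_iG_i$ (this limit is known always to exist). Write $0$ also for ${}^{\omega}0\in\mathcal{K}_G$; then $\tau_G^{\,i}(0)={}^{\omega}0\langle i\rangle_G$. For $s,t\in{}^{\omega}A$, $\Delta(s,t)=\min\{j\in\mathbb{N}: s_i=t_i \text{ for all } i\ge j\}$ if this set is non-empty, and $+\infty$ otherwise. The carry propagation at $s\in\mathcal{K}_G$ is $\mathsf{cp}_G(s)=\Delta(s,\tau_G(s))$. The system $(\mathcal{K}_G,\tau_G)$ is uniquely ergodic if there is exactly one $\tau_G$-invariant Borel probability measure on $\mathcal{K}_G$. Existence of $\mathsf{CP}_G$ means existence of a finite limit. *)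

theory Defs
  imports "HOL-Probability.Probability"
begin

text \<open>
  Finite words are lists of digits, most significant digit first. A left infinite word
  \<open>\<dots>s\<^sub>2s\<^sub>1s\<^sub>0\<close> is a function \<open>s :: nat \<Rightarrow> nat\<close> with \<open>s i\<close> the digit of weight \<open>G i\<close>; the product
  topology is the library topology on \<open>nat \<Rightarrow> nat\<close>, with \<open>nat\<close> discrete.
\<close>

definition greedy_basis :: "(nat \<Rightarrow> nat) \<Rightarrow> bool" where
  "greedy_basis G \<longleftrightarrow> strict_mono G \<and> G 0 = 1 \<and>
     bounded (range (\<lambda>l. real (G (Suc l)) / real (G l)))"

primrec greedy_division :: "(nat \<Rightarrow> nat) \<Rightarrow> nat \<Rightarrow> nat \<Rightarrow> nat list" where
  "greedy_division G 0 r = [r div G 0]"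
| "greedy_division G (Suc k) r = (r div G (Suc k)) # greedy_division G k (r mod G (Suc k))"

definition greedy_expansion :: "(nat \<Rightarrow> nat) \<Rightarrow> nat \<Rightarrow> nat list" where
  "greedy_expansion G N =
     (if N = 0 then [] else greedy_division G (THE k. G k \<le> N \<and> N < G (Suc k)) N)"

definition greedy_language :: "(nat \<Rightarrow> nat) \<Rightarrow> nat list set" where
  "greedy_language G = range (greedy_expansion G)"

text \<open>The smallest alphabet of consecutive integers starting at \<open>0\<close> that contains all digits.\<close>

definition alphabet :: "(nat \<Rightarrow> nat) \<Rightarrow> nat set" where
  "alphabet G = {a. \<exists>w \<in> greedy_language G. \<exists>d \<in> set w. a \<le> d}"

definition zero_extend :: "nat list \<Rightarrow> nat \<Rightarrow> nat" where
  "zero_extend w = (\<lambda>i. if i < length w then rev w ! i else 0)"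

text \<open>\<open>low_word s j\<close> is the word \<open>s\<^sub>j s\<^sub>j\<^sub>-\<^sub>1 \<dots> s\<^sub>0\<close>.\<close>

definition low_word :: "(nat \<Rightarrow> nat) \<Rightarrow> nat \<Rightarrow> nat list" where
  "low_word s j = rev (map s [0..<Suc j])"

definition compactification :: "(nat \<Rightarrow> nat) \<Rightarrow> (nat \<Rightarrow> nat) set" where
  "compactification G =
     {s. (\<forall>i. s i \<in> alphabet G) \<and>
         (\<forall>j. \<exists>m. \<exists>w \<in> greedy_language G. low_word s j = replicate m 0 @ w)}"

text \<open>
  The library's \<open>lim\<close> needs a \<open>t2_space\<close> instance, which \<open>nat \<Rightarrow> nat\<close> lacks; its defining
  description is written out instead.
\<close>

definition odometer :: "(nat \<Rightarrow> nat) \<Rightarrow> (nat \<Rightarrow> nat) \<Rightarrow> (nat \<Rightarrow> nat)" where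
  "odometer G s =
     (THE t. (\<lambda>j. zero_extend (greedy_expansion G ((\<Sum>i=0..j. s i * G i) + 1)))
               \<longlonglongrightarrow> t)"

definition Delta :: "(nat \<Rightarrow> nat) \<Rightarrow> (nat \<Rightarrow> nat) \<Rightarrow> enat" where
  "Delta s t =
     (if \<exists>j. \<forall>i\<ge>j. s i = t i then enat (LEAST j. \<forall>i\<ge>j. s i = t i) else \<infinity>)"

definition cp :: "(nat \<Rightarrow> nat) \<Rightarrow> (nat \<Rightarrow> nat) \<Rightarrow> enat" where
  "cp G s = Delta s (odometer G s)"

text \<open>
  A Borel probability measure on a subset \<open>K\<close> of a topological space lives on the subspace
  sigma-algebra \<open>restrict_space borel K\<close>.
\<close>

definition invariant_borel_prob ::
    "'a::topological_space set \<Rightarrow> ('a \<Rightarrow> 'a) \<Rightarrow> 'a measure \<Rightarrow> bool" where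
  "invariant_borel_prob K T \<mu> \<longleftrightarrow>
     sets \<mu> = sets (restrict_space borel K) \<and> prob_space \<mu> \<and>
     T \<in> measurable \<mu> \<mu> \<and> distr \<mu> \<mu> T = \<mu>"

definition uniquely_ergodic :: "'a::topological_space set \<Rightarrow> ('a \<Rightarrow> 'a) \<Rightarrow> bool" where
  "uniquely_ergodic K T \<longleftrightarrow> (\<exists>!\<mu>. invariant_borel_prob K T \<mu>)"

end

theory Submission
  imports Defs
begin

text \<open>
  Write \<open>low m s\<close> for the number \<open>\<Sum>i<m. s i * G i\<close> represented by the \<open>m\<close> lowest digits
  of \<open>s\<close>. Greediness means exactly \<open>low m s < G m\<close> for every \<open>m\<close>, and this inequality describes
  \<open>\<K>\<^sub>G\<close> (\<open>compactification_eq\<close>). Call the level \<open>l\<close> \<^emph>\<open>full\<close> at \<open>s\<close> if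
  \<open>low l s = G l - 1\<close>, so that adding one to the part below \<open>l\<close> overflows into the digit of
  weight \<open>G l\<close>; level \<open>0\<close> is always full. The odometer increments the digit at the highest full
  level and clears all digits below it, or returns zero if there are infinitely many full levels
  (\<open>odometer_eq_advance\<close>). Hence the carry propagation at the expansion of \<open>i\<close> is one more than
  the highest full level of \<open>i\<close> (\<open>cp_digits\<close>).

  Fullness is rare. If \<open>l\<close> is full at \<open>i\<close>, the odometer has just run \<open>low l\<close> from \<open>0\<close> through
  \<open>G l - 1\<close>, so the \<open>G l\<close> integers up to \<open>i\<close> form a block that no other such \<open>i\<close> shares,
  and the frequency of fullness at \<open>l\<close> among \<open>0, \<dots>, N - 1\<close> is at most \<open>1 / G l\<close>, uniformly in
  \<open>N\<close> (\<open>prob_orbit_full_le\<close>). The highest full level is a telescoping sum of contributions of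
  the levels; level \<open>l\<close> contributes at most \<open>l\<close>, and only where it is full, so its mean over
  \<open>0, \<dots>, N - 1\<close> is at most \<open>l / G l\<close>. These bounds are summable, and Tannery's theorem
  (dominated convergence for series) reduces the claim to the convergence, as \<open>N \<longlongrightarrow> \<infinity>\<close>, of the
  mean contribution of a single level, which depends on finitely many digits only
  (\<open>mean_highest_full_convergent\<close>).

  It remains to see that every pattern of low digits has a limiting frequency along the orbit of
  zero (\<open>orbit_law_tendsto\<close>). The map may be discontinuous, so the usual theorem on uniquely ergodic
  continuous maps does not apply as such, but its proof does. By compactness each sequence of
  times has a subsequence along which the frequencies of all patterns converge, and by
  Kolmogorov's extension theorem the limits are the cylinder probabilities of a Borel measure
  (\<open>exists_measure_with_laws\<close>). That measure is invariant: apart from the event that some level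
  above \<open>k\<close> is full, the low digits of the successor are a function of the \<open>k\<close> lowest digits,
  and this event has probability at most \<open>\<Sum>l>k. 1 / G l\<close>, both under the limit and
  along the orbit (\<open>invariant_limit_measure\<close>). By unique ergodicity all these limits agree, so the
  frequencies converge along the whole sequence.
\<close>

section \<open>Limits of sequences and of probability distributions\<close>

lemma tendsto_if_subsequences_tendsto:
  fixes X :: "nat \<Rightarrow> real"
  assumes "\<And>r. strict_mono (r :: nat \<Rightarrow> nat) \<Longrightarrow> \<exists>s. strict_mono s \<and> (\<lambda>n. X (r (s n))) \<longlonglongrightarrow> L"
  shows "X \<longlonglongrightarrow> L"
proof (rule ccontr)
  assume "\<not> X \<longlonglongrightarrow> L"
  then obtain e where e: "e > 0" "\<not> (\<forall>\<^sub>F n in sequentially. dist (X n) L < e)"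
    unfolding tendsto_iff by blast
  then have "infinite {n. \<not> dist (X n) L < e}"
    by (simp add: cofinite_eq_sequentially[symmetric] eventually_cofinite)
  then obtain r where r: "strict_mono (r :: nat \<Rightarrow> nat)" "\<And>n. \<not> dist (X (r n)) L < e"
    using infinite_enumerate[of "{n. \<not> dist (X n) L < e}"] by auto
  obtain s where "(\<lambda>n. X (r (s n))) \<longlonglongrightarrow> L" using assms[OF r(1)] by blast
  then have "\<forall>\<^sub>F n in sequentially. dist (X (r (s n))) L < e"
    using e(1) unfolding tendsto_iff by blast
  then show False using r(2) by simp
qed

text \<open>
  Sequential compactness of the countable power of the unit interval; it replaces a diagonal argument.
\<close>

lemma pointwise_convergent_subsequence:
  fixes F :: "nat \<Rightarrow> 'a::countable \<Rightarrow> real"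
  assumes "\<And>n x. F n x \<in> {0..1}"
  obtains s l where "strict_mono (s :: nat \<Rightarrow> nat)" "\<And>x. (\<lambda>n. F (s n) x) \<longlonglongrightarrow> l x"
proof -
  have "compactin (product_topology (\<lambda>_::'a. euclideanreal) UNIV) (PiE UNIV (\<lambda>_. {0..1}))"
    by (simp add: compactin_PiE)
  then have "compact (PiE UNIV (\<lambda>_::'a. {0..1::real}))"
    by (simp add: euclidean_product_topology)
  then have "seq_compact (PiE UNIV (\<lambda>_::'a. {0..1::real}))"
    by (rule compact_imp_seq_compact)
  moreover have "\<forall>n. F n \<in> PiE UNIV (\<lambda>_. {0..1})"
    using assms by (auto simp: PiE_def Pi_def)
  ultimately obtain l s where s: "strict_mono (s :: nat \<Rightarrow> nat)" "(F \<circ> s) \<longlonglongrightarrow> l"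
    by (metis seq_compactE)
  have "limitin (product_topology (\<lambda>_::'a. euclideanreal) UNIV) (F \<circ> s) l sequentially"
    using s(2) by (simp add: euclidean_product_topology)
  then have "(\<lambda>n. F (s n) x) \<longlonglongrightarrow> l x" for x
    by (simp add: limitin_componentwise)
  with s(1) that show thesis by blast
qed

text \<open>
  The common finite support prevents mass from escaping, so pointwise limits of these distributions
  are again distributions.
\<close>

lemma pmf_tendsto_measure:
  fixes P :: "nat \<Rightarrow> nat pmf"
  assumes supp: "\<And>n. set_pmf (P n) \<subseteq> {..<b}"
    and lim: "\<And>v. (\<lambda>n. pmf (P n) v) \<longlonglongrightarrow> p v"
  obtains q where "set_pmf q \<subseteq> {..<b}"
    "\<And>A. (\<lambda>n. measure (measure_pmf (P n)) A) \<longlonglongrightarrow> measure (measure_pmf q) A"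
proof -
  have nonneg: "0 \<le> p v" for v
    by (rule LIMSEQ_le_const[OF lim]) (simp add: pmf_nonneg)
  have zero: "p v = 0" if "v \<ge> b" for v
  proof -
    have "pmf (P n) v = 0" for n
      using supp[of n] that by (auto simp: pmf_eq_0_set_pmf)
    then show ?thesis using lim[of v] by (simp add: LIMSEQ_const_iff)
  qed
  have "(\<lambda>n. \<Sum>v<b. pmf (P n) v) \<longlonglongrightarrow> (\<Sum>v<b. p v)"
    by (intro tendsto_sum lim)
  moreover have "(\<Sum>v<b. pmf (P n) v) = 1" for n
    using supp by (intro sum_pmf_eq_1) auto
  ultimately have sum: "(\<Sum>v<b. p v) = 1"
    by (simp add: LIMSEQ_const_iff)
  have "(\<integral>\<^sup>+v. ennreal (p v) \<partial>count_space UNIV) = (\<integral>\<^sup>+v. ennreal (p v) \<partial>count_space {..<b})"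
    by (rule nn_integral_count_space_eq) (use zero in \<open>auto simp: not_less\<close>)
  also have "\<dots> = 1"
    using sum by (simp add: nn_integral_count_space_finite nonneg flip: ennreal_1)
  finally have one: "(\<integral>\<^sup>+v. ennreal (p v) \<partial>count_space UNIV) = 1" .
  define q where "q = embed_pmf p"
  have q: "pmf q v = p v" for v
    unfolding q_def by (rule pmf_embed_pmf) (use nonneg one in auto)
  have supp_q: "set_pmf q \<subseteq> {..<b}"
    using zero by (auto simp: set_pmf_eq q not_less) (metis not_less)
  have on_support: "measure (measure_pmf r) A = (\<Sum>v\<in>A \<inter> {..<b}. pmf r v)"
    if "set_pmf r \<subseteq> {..<b}" for r :: "nat pmf" and A
  proof -
    have "measure (measure_pmf r) A = measure (measure_pmf r) (A \<inter> {..<b})"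
      using that by (intro measure_pmf.finite_measure_eq_AE) (auto simp: AE_measure_pmf_iff)
    then show ?thesis by (simp add: measure_measure_pmf_finite)
  qed
  have "(\<lambda>n. measure (measure_pmf (P n)) A) \<longlonglongrightarrow> measure (measure_pmf q) A" for A
    unfolding on_support[OF supp] on_support[OF supp_q] q by (intro tendsto_sum lim)
  with supp_q that show thesis by blast
qed

lemma (in prob_space) prob_exists_le:
  fixes c :: "nat \<Rightarrow> real"
  assumes "summable c"
    and [measurable]: "\<And>l. Measurable.pred M (P l)"
    and le: "\<And>l. prob {x \<in> space M. P l x} \<le> c l"
  shows "prob {x \<in> space M. \<exists>l>k. P l x} \<le> (\<Sum>l. c (l + Suc k))"
proof -
  have sum: "summable (\<lambda>l. c (l + Suc k))"
    using assms(1) by (rule summable_ignore_initial_segment)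
  have sum': "summable (\<lambda>l. prob {x \<in> space M. P (l + Suc k) x})"
    by (rule summable_comparison_test'[OF sum]) (use le in auto)
  have "{x \<in> space M. \<exists>l>k. P l x} = (\<Union>l. {x \<in> space M. P (l + Suc k) x})"
  proof (intro equalityI subsetI)
    fix x assume "x \<in> {x \<in> space M. \<exists>l>k. P l x}"
    then obtain l where l: "x \<in> space M" "l > k" "P l x" by blast
    then have "P ((l - Suc k) + Suc k) x" by simp
    with l(1) show "x \<in> (\<Union>l. {x \<in> space M. P (l + Suc k) x})" by blast
  next
    fix x assume "x \<in> (\<Union>l. {x \<in> space M. P (l + Suc k) x})"
    then obtain l where "x \<in> space M" "P (l + Suc k) x" by blast
    moreover have "l + Suc k > k" by simp
    ultimately show "x \<in> {x \<in> space M. \<exists>l>k. P l x}" by blast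
  qed
  also have "prob \<dots> \<le> (\<Sum>l. prob {x \<in> space M. P (l + Suc k) x})"
    by (rule finite_measure_subadditive_countably[OF _ sum']) auto
  also have "\<dots> \<le> (\<Sum>l. c (l + Suc k))"
    by (rule suminf_le[OF le sum' sum])
  finally show ?thesis .
qed

section \<open>Words and their low parts\<close>

locale greedy_numeration =
  fixes G :: "nat \<Rightarrow> nat"
  assumes strict_mono_G: "strict_mono G" and G_0 [simp]: "G 0 = 1"
begin

definition low :: "nat \<Rightarrow> (nat \<Rightarrow> nat) \<Rightarrow> nat" where
  "low m s = (\<Sum>i<m. s i * G i)"

definition admissible :: "(nat \<Rightarrow> nat) set" where
  "admissible = {s. \<forall>m. low m s < G m}"

definition truncate :: "nat \<Rightarrow> (nat \<Rightarrow> nat) \<Rightarrow> nat \<Rightarrow> nat" where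
  "truncate m s = (\<lambda>i. if i < m then s i else 0)"

definition digits :: "nat \<Rightarrow> nat \<Rightarrow> nat" where
  "digits N = zero_extend (greedy_expansion G N)"

text \<open>
  Level \<open>0\<close> is full at every word, since the empty sum is \<open>G 0 - 1\<close>. This makes the increment of
  the digit \<open>s 0\<close> without any carry an instance of the general rule.
\<close>

definition full :: "nat \<Rightarrow> (nat \<Rightarrow> nat) \<Rightarrow> bool" where
  "full l s \<longleftrightarrow> Suc (low l s) = G l"

text \<open>
  This is the odometer on \<open>admissible\<close>, in a form without limits: each digit is decided by which
  levels are full, so that the map is visibly measurable and defined on all words. With infinitely
  many full levels the first case applies at every index, and the result is zero.
\<close>

definition advance :: "(nat \<Rightarrow> nat) \<Rightarrow> nat \<Rightarrow> nat" where
  "advance s i = (if \<exists>l>i. full l s then 0 else if full i s then Suc (s i) else s i)"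

lemma G_le: "m \<le> n \<Longrightarrow> G m \<le> G n"
  using strict_mono_G by (simp add: strict_mono_less_eq)

lemma G_less: "m < n \<Longrightarrow> G m < G n"
  using strict_mono_G by (simp add: strict_mono_less)

lemma G_pos [simp]: "0 < G m"
  using G_le[of 0 m] by simp

lemma less_G: "n < G n"
proof (induction n)
  case (Suc n)
  then show ?case using G_less[of n "Suc n"] by simp
qed simp

lemma low_0 [simp]: "low 0 s = 0"
  by (simp add: low_def)

lemma low_Suc [simp]: "low (Suc m) s = low m s + s m * G m"
  by (simp add: low_def)

lemma low_cong: "(\<And>i. i < m \<Longrightarrow> s i = t i) \<Longrightarrow> low m s = low m t"
  by (simp add: low_def)

lemma admissibleD: "s \<in> admissible \<Longrightarrow> low m s < G m"
  by (simp add: admissible_def)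

text \<open>
  On admissible words \<open>s m\<close> and \<open>low m s\<close> are quotient and remainder of \<open>low (Suc m) s\<close> by \<open>G m\<close>,
  so all digits below \<open>m\<close> can be read off from \<open>low m s\<close>.
\<close>

lemma admissible_agree:
  assumes "s \<in> admissible" "t \<in> admissible" "low m s = low m t" "i < m"
  shows "s i = t i"
  using assms(3,4)
proof (induction m)
  case (Suc m)
  have "s m = low (Suc m) s div G m" "t m = low (Suc m) t div G m"
    using admissibleD[OF assms(1), of m] admissibleD[OF assms(2), of m] by simp_all
  moreover have "low m s = low (Suc m) s mod G m" "low m t = low (Suc m) t mod G m"
    using admissibleD[OF assms(1), of m] admissibleD[OF assms(2), of m] by simp_all
  ultimately show ?case
    using Suc by (metis less_Suc_eq)
qed simp

lemma low_truncate: "low k (truncate m s) = low (min k m) s"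
proof (induction k)
  case (Suc k)
  then show ?case
    by (cases "k < m") (auto simp: truncate_def min_def le_Suc_eq)
qed simp

lemma truncate_admissible: "s \<in> admissible \<Longrightarrow> truncate m s \<in> admissible"
  by (auto simp: admissible_def low_truncate intro: order_less_le_trans[OF _ G_le])

section \<open>Greedy expansions as admissible words\<close>

lemma length_greedy_division [simp]: "length (greedy_division G k r) = Suc k"
  by (induction k arbitrary: r) auto

lemma zero_extend_greedy_division_Suc:
  "zero_extend (greedy_division G (Suc k) r) =
     (\<lambda>i. if i = Suc k then r div G (Suc k)
          else zero_extend (greedy_division G k (r mod G (Suc k))) i)"
  by (auto simp: zero_extend_def fun_eq_iff nth_append less_Suc_eq)

lemma greedy_division_low:
  assumes "r < G (Suc k)"
  shows "low (Suc k) (zero_extend (greedy_division G k r)) = r"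
    and "zero_extend (greedy_division G k r) \<in> admissible"
proof -
  have "low (Suc k) (zero_extend (greedy_division G k r)) = r \<and>
        (\<forall>m\<le>Suc k. low m (zero_extend (greedy_division G k r)) < G m)"
    using assms
  proof (induction k arbitrary: r)
    case 0
    then show ?case
      by (auto simp: zero_extend_def le_Suc_eq)
  next
    case (Suc k)
    let ?s = "zero_extend (greedy_division G (Suc k) r)"
    let ?t = "zero_extend (greedy_division G k (r mod G (Suc k)))"
    have same: "low m ?s = low m ?t" if "m \<le> Suc k" for m
      using that by (intro low_cong) (auto simp: zero_extend_greedy_division_Suc simp del: greedy_division.simps)
    have IH: "low (Suc k) ?t = r mod G (Suc k)" "\<forall>m\<le>Suc k. low m ?t < G m"
      using Suc.IH[of "r mod G (Suc k)"] by simp_all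
    have top: "?s (Suc k) = r div G (Suc k)"
      by (simp add: zero_extend_greedy_division_Suc del: greedy_division.simps)
    have "low (Suc (Suc k)) ?s = low (Suc k) ?s + ?s (Suc k) * G (Suc k)"
      by (rule low_Suc)
    also have "\<dots> = r mod G (Suc k) + r div G (Suc k) * G (Suc k)"
      by (simp only: same[OF order_refl] IH top)
    finally have eq: "low (Suc (Suc k)) ?s = r"
      by (simp only: mod_div_mult_eq)
    show ?case
    proof (intro conjI allI impI eq)
      fix m assume "m \<le> Suc (Suc k)"
      then consider "m = Suc (Suc k)" | "m \<le> Suc k" by linarith
      then show "low m ?s < G m"
      proof cases
        case 1
        then show ?thesis using eq Suc.prems by (simp only:)
      next
        case 2
        then show ?thesis using IH(2) same[OF 2] by (simp only: simp_thms)
      qed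
    qed
  qed
  then have *: "low (Suc k) (zero_extend (greedy_division G k r)) = r"
    "\<And>m. m \<le> Suc k \<Longrightarrow> low m (zero_extend (greedy_division G k r)) < G m"
    by auto
  show "low (Suc k) (zero_extend (greedy_division G k r)) = r" by fact
  have "truncate (Suc k) (zero_extend (greedy_division G k r)) = zero_extend (greedy_division G k r)"
    by (auto simp: truncate_def zero_extend_def fun_eq_iff)
  then have "low m (zero_extend (greedy_division G k r)) =
      low (min m (Suc k)) (zero_extend (greedy_division G k r))" for m
    by (metis low_truncate)
  then have "low m (zero_extend (greedy_division G k r)) < G m" for m
    using order_less_le_trans[OF *(2)[OF min.cobounded2] G_le[OF min.cobounded1]] by metis
  then show "zero_extend (greedy_division G k r) \<in> admissible"
    by (simp add: admissible_def)
qed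

lemma greedy_length:
  assumes "0 < N"
  obtains k where "G k \<le> N" "N < G (Suc k)" "greedy_expansion G N = greedy_division G k N"
proof -
  define k where "k = (LEAST k. N < G (Suc k))"
  have ex: "N < G (Suc N)" using less_G[of N] G_le[of N "Suc N"] by simp
  have 1: "N < G (Suc k)" unfolding k_def by (rule LeastI, rule ex)
  have 2: "G k \<le> N"
  proof (cases k)
    case (Suc j)
    then show ?thesis using not_less_Least[of j "\<lambda>k. N < G (Suc k)"] unfolding k_def by auto
  qed (use assms in simp)
  have "(THE k. G k \<le> N \<and> N < G (Suc k)) = k"
  proof (rule the_equality)
    fix j assume j: "G j \<le> N \<and> N < G (Suc j)"
    then have "G j < G (Suc k)" "G k < G (Suc j)" using 1 2 by auto
    then show "j = k" using strict_mono_G by (simp add: strict_mono_less)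
  qed (use 1 2 in simp)
  then show ?thesis using that[of k] 1 2 assms by (simp add: greedy_expansion_def)
qed

lemma digits_admissible: "digits N \<in> admissible"
proof (cases "N = 0")
  case True
  then show ?thesis by (auto simp: digits_def greedy_expansion_def zero_extend_def admissible_def low_def)
next
  case False
  then obtain k where "N < G (Suc k)" "greedy_expansion G N = greedy_division G k N"
    by (metis greedy_length neq0_conv)
  then show ?thesis unfolding digits_def by (simp add: greedy_division_low)
qed

lemma low_digits:
  assumes "N < G m"
  shows "low m (digits N) = N"
proof (cases "N = 0")
  case True
  then show ?thesis by (auto simp: digits_def greedy_expansion_def zero_extend_def low_def)
next
  case False
  then obtain k where k: "G k \<le> N" "N < G (Suc k)" "greedy_expansion G N = greedy_division G k N"
    by (metis greedy_length neq0_conv)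
  have "G k < G m" using k assms by simp
  then have "Suc k \<le> m" using strict_mono_G by (simp add: strict_mono_less)
  moreover have "truncate (Suc k) (digits N) = digits N"
    using k by (auto simp: truncate_def zero_extend_def digits_def fun_eq_iff)
  ultimately have "low m (digits N) = low (Suc k) (digits N)"
    by (metis low_truncate min.absorb2)
  then show ?thesis unfolding digits_def using k greedy_division_low(1) by simp
qed

lemma eq_digitsI:
  assumes "s \<in> admissible" "\<And>k. k \<ge> m \<Longrightarrow> low k s = N"
  shows "s = digits N"
proof
  fix i
  define k where "k = max (max m (Suc i)) N"
  have "low k s = N" using assms(2)[of k] unfolding k_def by simp
  moreover have "low k (digits N) = N" by (rule low_digits) (use less_G[of k] in \<open>simp add: k_def\<close>)
  ultimately show "s i = digits N i"
    using admissible_agree[OF assms(1) digits_admissible, of k N i] by (simp add: k_def)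
qed

lemma truncate_eq_digits:
  assumes "s \<in> admissible"
  shows "truncate m s = digits (low m s)"
  by (rule eq_digitsI[of _ m]) (simp_all add: truncate_admissible assms low_truncate min_def)

text \<open>
  The numbers \<open>low m s\<close> determine each other downwards. This lets every event about finitely many
  low digits be stated as an event about one natural number below \<open>G m\<close>.
\<close>

lemma low_low:
  assumes "s \<in> admissible" "l \<le> m"
  shows "low l (digits (low m s)) = low l s"
  using assms by (simp flip: truncate_eq_digits add: low_truncate)

section \<open>The compactification\<close>

lemma zero_extend_low_word: "zero_extend (low_word s j) = truncate (Suc j) s"
  by (auto simp: zero_extend_def low_word_def truncate_def fun_eq_iff simp del: upt_Suc)

lemma zero_extend_replicate: "zero_extend (replicate a 0 @ w) = zero_extend w"
  by (auto simp: zero_extend_def fun_eq_iff nth_append)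

lemma zero_extend_inject:
  assumes "zero_extend u = zero_extend w" "length u = length w"
  shows "u = w"
proof -
  have "rev u ! i = rev w ! i" if "i < length w" for i
    using fun_cong[OF assms(1), of i] assms(2) that by (simp add: zero_extend_def)
  then have "rev u = rev w" using assms(2) by (intro nth_equalityI) auto
  then show ?thesis by simp
qed

text \<open>
  A low word belongs to \<open>0\<^sup>*L\<^sub>G\<close> exactly if it is the padded expansion of its own value \<open>low\<close>.
  Membership of the digits in the alphabet is then automatic: nonzero digits occur in an expansion,
  and \<open>0\<close> lies below the digit of the expansion of \<open>1\<close>.
\<close>

lemma compactification_eq: "compactification G = admissible"
proof (intro equalityI subsetI)
  fix s assume s: "s \<in> compactification G"
  have "low m s < G m" for m
  proof (cases m)
    case (Suc j)
    obtain a N where "low_word s j = replicate a 0 @ greedy_expansion G N"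
      using s unfolding compactification_def greedy_language_def by blast
    then have "truncate (Suc j) s = digits N"
      by (metis zero_extend_low_word zero_extend_replicate digits_def)
    then show ?thesis
      using admissibleD[OF digits_admissible[of N], of m] low_truncate[of m m s] Suc by simp
  qed simp
  then show "s \<in> admissible" by (simp add: admissible_def)
next
  fix s assume s: "s \<in> admissible"
  have word: "\<exists>a. \<exists>w \<in> greedy_language G. low_word s j = replicate a 0 @ w" for j
  proof -
    define N where "N = low (Suc j) s"
    define w where "w = greedy_expansion G N"
    have "N < G (Suc j)" using admissibleD[OF s] unfolding N_def .
    then have len: "length w \<le> Suc j"
    proof (cases "N = 0")
      case False
      then obtain k where k: "G k \<le> N" "greedy_expansion G N = greedy_division G k N"
        by (metis greedy_length neq0_conv)
      then have "G k < G (Suc j)" using \<open>N < G (Suc j)\<close> by simp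
      then show ?thesis using k strict_mono_G unfolding w_def by (simp add: strict_mono_less)
    qed (simp add: w_def greedy_expansion_def)
    have "zero_extend (low_word s j) = zero_extend (replicate (Suc j - length w) 0 @ w)"
      unfolding zero_extend_low_word zero_extend_replicate truncate_eq_digits[OF s] digits_def w_def N_def ..
    then have "low_word s j = replicate (Suc j - length w) 0 @ w"
      by (rule zero_extend_inject) (use len in \<open>simp add: low_word_def\<close>)
    then show ?thesis unfolding w_def greedy_language_def by blast
  qed
  have "s i \<in> alphabet G" for i
  proof -
    obtain a w where w: "w \<in> greedy_language G" "low_word s i = replicate a 0 @ w" using word by blast
    have mem: "s i \<in> set (low_word s i)" by (simp add: low_word_def)
    show ?thesis
    proof (cases "s i = 0")
      case True
      obtain k where "greedy_expansion G 1 = greedy_division G k 1"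
        by (metis greedy_length zero_less_one)
      then obtain d where "d \<in> set (greedy_expansion G 1)"
        by (metis length_greedy_division list.set_sel(1) length_0_conv nat.distinct(1))
      then have "\<exists>w \<in> greedy_language G. \<exists>d \<in> set w. s i \<le> d"
        using True unfolding greedy_language_def
        by (intro bexI[of _ "greedy_expansion G 1"] bexI[of _ d]) simp_all
      then show ?thesis unfolding alphabet_def by simp
    next
      case False
      then have "s i \<in> set w" using mem w(2) by auto
      then show ?thesis using w(1) unfolding alphabet_def by blast
    qed
  qed
  then show "s \<in> compactification G" using word unfolding compactification_def by blast
qed

section \<open>The odometer and its carries\<close>

lemma full_truncate_iff:
  assumes "s \<in> admissible"
  shows "full l (truncate m s) \<longleftrightarrow> l \<le> m \<and> full l s"
proof (cases "l \<le> m")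
  case False
  have "G m < G l" using False by (intro G_less) simp
  then show ?thesis
    using False admissibleD[OF assms, of m] by (auto simp: full_def low_truncate min_def)
qed (auto simp: full_def low_truncate min_def)

text \<open>
  If some level at or above \<open>m\<close> is full, the carry passes through and clears everything below \<open>m\<close>;
  otherwise the carry stops below \<open>m\<close> and the represented number grows by one. Preservation of
  admissibility and the arithmetic meaning of \<open>advance\<close> both follow from this formula.
\<close>

lemma low_advance: "low m (advance s) = (if \<exists>l\<ge>m. full l s then 0 else Suc (low m s))"
proof (induction m)
  case 0
  then show ?case by (auto simp: full_def intro: exI[of _ 0])
next
  case (Suc m)
  show ?case
  proof (cases "\<exists>l\<ge>Suc m. full l s")
    case True
    then have "\<exists>l\<ge>m. full l s" "\<exists>l>m. full l s" by (auto simp: Suc_le_eq intro: less_imp_le)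
    moreover from this have "advance s m = 0" by (simp add: advance_def)
    ultimately show ?thesis using True Suc by simp
  next
    case False
    then have no: "\<not> (\<exists>l>m. full l s)" by (auto simp: Suc_le_eq)
    show ?thesis
    proof (cases "full m s")
      case True
      then have "low m (advance s) = 0" using Suc by auto
      moreover have "Suc (low m s) = G m" using True by (simp add: full_def)
      moreover have "advance s m = Suc (s m)" using no True by (simp add: advance_def)
      ultimately show ?thesis using False by simp
    next
      case nf: False
      then have "\<not> (\<exists>l\<ge>m. full l s)" using no by (metis le_neq_implies_less)
      moreover have "advance s m = s m" using no nf by (auto simp add: advance_def)
      ultimately show ?thesis using Suc False by simp
    qed
  qed
qed

lemma advance_admissible:
  assumes "s \<in> admissible"
  shows "advance s \<in> admissible"
proof -
  have "low m (advance s) < G m" for m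
  proof (cases "\<exists>l\<ge>m. full l s")
    case False
    then have "\<not> full m s" by auto
    then show ?thesis using False admissibleD[OF assms, of m] by (auto simp: low_advance full_def)
  qed (simp add: low_advance)
  then show ?thesis by (simp add: admissible_def)
qed

lemma not_full_digits: "Suc N < G l \<Longrightarrow> \<not> full l (digits N)"
  using low_digits[of N l] by (simp add: full_def)

lemma advance_digits: "advance (digits N) = digits (Suc N)"
proof (rule eq_digitsI[of _ "Suc (Suc N)"])
  show "advance (digits N) \<in> admissible" by (simp add: advance_admissible digits_admissible)
  fix k assume k: "k \<ge> Suc (Suc N)"
  have "Suc N < G l" if "l \<ge> k" for l using less_G[of l] that k by simp
  then have "\<not> (\<exists>l\<ge>k. full l (digits N))" by (blast dest: not_full_digits)
  moreover have "N < G k" using less_G[of k] k by simp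
  ultimately show "low k (advance (digits N)) = Suc N" by (simp add: low_advance low_digits)
qed

lemma tendsto_fun_nat:
  fixes f :: "nat \<Rightarrow> nat \<Rightarrow> nat"
  shows "f \<longlonglongrightarrow> t \<longleftrightarrow> (\<forall>i. \<forall>\<^sub>F j in sequentially. f j i = t i)"
proof -
  have "f \<longlonglongrightarrow> t \<longleftrightarrow> limitin (product_topology (\<lambda>i. euclidean) UNIV) f t sequentially"
    by (simp add: euclidean_product_topology flip: limitin_canonical_iff)
  also have "\<dots> \<longleftrightarrow> (\<forall>i. \<forall>\<^sub>F j in sequentially. f j i = t i)"
    by (simp add: limitin_componentwise tendsto_discrete)
  finally show ?thesis .
qed

text \<open>
  The approximants in the definition of the odometer are the values of \<open>advance\<close> at truncations of
  \<open>s\<close>. Truncation at length \<open>m\<close> keeps the full levels up to \<open>m\<close> and removes those above, so each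
  single digit of the approximants is eventually constant.
\<close>

lemma odometer_eq_advance:
  assumes s: "s \<in> admissible"
  shows "odometer G s = advance s"
proof -
  have step: "zero_extend (greedy_expansion G ((\<Sum>i=0..j. s i * G i) + 1)) = advance (truncate (Suc j) s)" for j
  proof -
    have "(\<Sum>i=0..j. s i * G i) = low (Suc j) s"
      unfolding low_def by (rule sum.cong) auto
    then show ?thesis by (simp add: truncate_eq_digits[OF s] advance_digits flip: digits_def)
  qed
  have lim: "(\<lambda>j. advance (truncate (Suc j) s)) \<longlonglongrightarrow> advance s"
    unfolding tendsto_fun_nat
  proof
    fix i
    obtain j0 where j0: "j0 \<ge> i" "(\<exists>l>i. full l s) \<longrightarrow> (\<exists>l>i. full l s \<and> l \<le> j0)"
      by (metis nle_le)
    show "\<forall>\<^sub>F j in sequentially. advance (truncate (Suc j) s) i = advance s i"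
      using eventually_ge_at_top[of j0]
    proof eventually_elim
      case (elim j)
      have "(\<exists>l>i. full l (truncate (Suc j) s)) \<longleftrightarrow> (\<exists>l>i. full l s)"
        using j0(2) elim by (auto simp: full_truncate_iff[OF s])
      moreover have "truncate (Suc j) s i = s i"
        using j0(1) elim by (simp add: truncate_def)
      moreover have "full i (truncate (Suc j) s) = full i s"
        using j0(1) elim by (simp add: full_truncate_iff[OF s])
      ultimately show ?case unfolding advance_def by (simp only:)
    qed
  qed
  show ?thesis
    unfolding odometer_def step
  proof (rule the_equality, rule lim)
    fix t assume t: "(\<lambda>j. advance (truncate (Suc j) s)) \<longlonglongrightarrow> t"
    show "t = advance s"
    proof
      fix i
      have "\<forall>\<^sub>F j in sequentially. advance (truncate (Suc j) s) i = t i \<and> advance (truncate (Suc j) s) i = advance s i"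
        using t lim unfolding tendsto_fun_nat by (auto intro: eventually_conj)
      then show "t i = advance s i" by (auto simp: eventually_sequentially)
    qed
  qed
qed

lemma digits_0: "digits 0 = (\<lambda>_. 0)"
  by (simp add: digits_def greedy_expansion_def zero_extend_def fun_eq_iff)

lemma odometer_funpow_0: "(odometer G ^^ i) (\<lambda>_. 0) = digits i"
  by (induction i) (simp_all add: digits_0 odometer_eq_advance digits_admissible advance_digits)

text \<open>
  The bound \<open>k\<close> keeps this a function of \<open>low k s\<close>, and the increments in \<open>k\<close> are what is averaged
  level by level later. The value \<open>0\<close> in the first equation is correct because level \<open>0\<close> is full.
\<close>

primrec highest_full :: "nat \<Rightarrow> (nat \<Rightarrow> nat) \<Rightarrow> nat" where
  "highest_full 0 s = 0"
| "highest_full (Suc l) s = (if full (Suc l) s then Suc l else highest_full l s)"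

lemma highest_full_is_full: "full (highest_full k s) s"
  by (induction k) (auto simp: full_def)

lemma highest_full_ge: "full l s \<Longrightarrow> l \<le> k \<Longrightarrow> l \<le> highest_full k s"
  by (induction k) (auto simp: le_Suc_eq)

lemma highest_full_le: "highest_full k s \<le> k"
  by (induction k) auto

text \<open>
  \<open>advance\<close> changes the digit at the highest full level and none above it. All levels above \<open>N\<close> are
  out of reach for \<open>digits N\<close>, whose value is too small to fill them.
\<close>

lemma cp_digits:
  assumes "N < k"
  shows "cp G (digits N) = enat (Suc (highest_full k (digits N)))"
proof -
  define L where "L = highest_full k (digits N)"
  have nf: "\<not> full l (digits N)" if "l > L" for l
  proof (cases "l \<le> k")
    case True
    then show ?thesis using highest_full_ge[of l "digits N" k] that unfolding L_def by auto
  next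
    case False
    then show ?thesis using not_full_digits[of N l] less_G[of l] assms by simp
  qed
  have "digits N L \<noteq> advance (digits N) L"
    using nf highest_full_is_full[of k "digits N"] unfolding L_def[symmetric] by (auto simp: advance_def)
  moreover have agree: "digits N i = advance (digits N) i" if "i > L" for i
    using nf that by (auto simp: advance_def dest: less_trans)
  ultimately have "(LEAST j. \<forall>i\<ge>j. digits N i = advance (digits N) i) = Suc L"
    by (intro Least_equality) (auto simp: Suc_le_eq not_less[symmetric])
  moreover have "\<exists>j. \<forall>i\<ge>j. digits N i = advance (digits N) i"
    using agree by (intro exI[of _ "Suc L"]) simp
  ultimately show ?thesis
    by (simp add: cp_def Delta_def odometer_eq_advance digits_admissible L_def)
qed

section \<open>Frequencies along the orbit of zero\<close>

lemma low_digits_Suc: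
  "low m (digits (Suc i)) = (if \<exists>l\<ge>m. full l (digits i) then 0 else Suc (low m (digits i)))"
  by (simp add: low_advance flip: advance_digits)

text \<open>
  Going back from \<open>i\<close>, the number \<open>low m\<close> decreases in unit steps until it reaches zero: by
  \<open>low_digits_Suc\<close> a positive value can only arise by adding one.
\<close>

lemma low_digits_diff:
  "r \<le> low m (digits i) \<Longrightarrow> r \<le> i \<and> low m (digits (i - r)) = low m (digits i) - r"
proof (induction r)
  case (Suc r)
  then have IH: "r \<le> i" "low m (digits (i - r)) = low m (digits i) - r" by auto
  have "i - r \<noteq> 0"
  proof
    assume "i - r = 0"
    then have "low m (digits i) - r = 0" using IH by (simp add: digits_0 low_def)
    with Suc.prems show False by simp
  qed
  then obtain j where j: "i - r = Suc j" using not0_implies_Suc by blast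
  then have "low m (digits j) = low m (digits i) - Suc r"
    using IH(2) Suc.prems low_digits_Suc[of m j] by (auto split: if_splits)
  moreover have "i - Suc r = j" "Suc r \<le> i" using j by auto
  ultimately show ?case by simp
qed simp

text \<open>
  An integer \<open>i\<close> that is full at \<open>l\<close> ends a run of \<open>G l\<close> integers on which \<open>low l\<close> takes the values
  \<open>0, \<dots>, G l - 1\<close> in turn. The value of \<open>low l\<close> locates the end of the run, so different runs are
  disjoint.
\<close>

lemma card_full_le: "card {i. i < N \<and> full l (digits i)} * G l \<le> N"
proof -
  let ?A = "{i. i < N \<and> full l (digits i)}"
  have at: "low l (digits (i - r)) = G l - Suc r" "r \<le> i" if "i \<in> ?A" "r < G l" for i r
  proof -
    have full: "Suc (low l (digits i)) = G l" using that by (simp add: full_def)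
    then have "r \<le> low l (digits i)" using that by simp
    from low_digits_diff[OF this] full show "low l (digits (i - r)) = G l - Suc r" "r \<le> i" by simp_all
  qed
  have "inj_on (\<lambda>(i, r). i - r) (?A \<times> {..<G l})"
  proof (rule inj_onI, clarify)
    fix i r i' r' assume *: "i < N" "full l (digits i)" "r < G l" "i' < N" "full l (digits i')" "r' < G l"
      and eq: "i - r = i' - r'"
    have "G l - Suc r = G l - Suc r'" "r \<le> i" "r' \<le> i'"
      using at[of i r] at[of i' r'] * eq by simp_all
    then show "i = i' \<and> r = r'" using * eq by auto
  qed
  moreover have "(\<lambda>(i, r). i - r) ` (?A \<times> {..<G l}) \<subseteq> {..<N}" by auto
  ultimately have "card (?A \<times> {..<G l}) \<le> card {..<N}"
    by (intro card_inj_on_le) auto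
  then show ?thesis by simp
qed

text \<open>
  Frequencies among the first integers are treated as probabilities, so that the same union bounds
  serve the orbit and the limit measures. The successor avoids the empty sample.
\<close>

abbreviation orbit :: "nat \<Rightarrow> nat pmf" where
  "orbit N \<equiv> pmf_of_set {..<Suc N}"

lemma prob_orbit: "measure (measure_pmf (orbit N)) {i. P i} = card {i. i < Suc N \<and> P i} / Suc N"
proof -
  have "{..<Suc N} \<inter> {i. P i} = {i. i < Suc N \<and> P i}" by auto
  then show ?thesis by (subst measure_pmf_of_set) (auto simp: lessThan_empty_iff)
qed

lemma prob_orbit_full_le: "measure (measure_pmf (orbit N)) {i. full l (digits i)} \<le> 1 / G l"
proof -
  have "real (card {i. i < Suc N \<and> full l (digits i)}) * real (G l) \<le> real (Suc N)"
    using card_full_le[of "Suc N" l] by (metis of_nat_le_iff of_nat_mult)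
  then show ?thesis unfolding prob_orbit by (simp add: field_simps)
qed

text \<open>
  Shifting the window by one changes a count by at most one; this makes limits of the empirical
  measures invariant.
\<close>

lemma prob_orbit_shift:
  "measure (measure_pmf (orbit N)) {i. P (Suc i)} \<le> measure (measure_pmf (orbit N)) {i. P i} + 1 / Suc N"
proof -
  have "Suc ` {i. i < Suc N \<and> P (Suc i)} \<subseteq> insert (Suc N) {i. i < Suc N \<and> P i}" by auto
  then have "card (Suc ` {i. i < Suc N \<and> P (Suc i)}) \<le> card (insert (Suc N) {i. i < Suc N \<and> P i})"
    by (intro card_mono) auto
  also have "\<dots> \<le> Suc (card {i. i < Suc N \<and> P i})" by (rule card_insert_le_m1) auto
  finally have "real (card {i. i < Suc N \<and> P (Suc i)}) \<le> real (card {i. i < Suc N \<and> P i}) + 1"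
    by (simp add: card_image)
  then show ?thesis unfolding prob_orbit add_divide_distrib[symmetric] by (intro divide_right_mono) auto
qed

definition orbit_law :: "nat \<Rightarrow> nat \<Rightarrow> nat pmf" where
  "orbit_law N m = map_pmf (\<lambda>i. low m (digits i)) (orbit N)"

lemma measure_orbit_law:
  "measure (measure_pmf (orbit_law N m)) A = measure (measure_pmf (orbit N)) {i. low m (digits i) \<in> A}"
  by (simp add: orbit_law_def vimage_def)

lemma set_orbit_law: "set_pmf (orbit_law N m) \<subseteq> {..<G m}"
  using admissibleD[OF digits_admissible] by (auto simp: orbit_law_def)

definition tail :: "nat \<Rightarrow> real" where
  "tail k = (\<Sum>l. 1 / real (G (l + Suc k)))"

lemma tail_tendsto_0:
  assumes "summable (\<lambda>l. 1 / real (G l))"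
  shows "tail \<longlonglongrightarrow> 0"
proof -
  have "tail k = (\<Sum>l. 1 / real (G l)) - (\<Sum>l<Suc k. 1 / real (G l))" for k
    unfolding tail_def using suminf_split_initial_segment[OF assms, of "Suc k"] by simp
  then have "tail = (\<lambda>k. (\<Sum>l. 1 / real (G l)) - (\<Sum>l<Suc k. 1 / real (G l)))"
    by (rule ext)
  moreover have "(\<lambda>k. (\<Sum>l. 1 / real (G l)) - (\<Sum>l<Suc k. 1 / real (G l))) \<longlonglongrightarrow> (\<Sum>l. 1 / real (G l)) - (\<Sum>l. 1 / real (G l))"
    by (intro tendsto_diff tendsto_const LIMSEQ_Suc summable_LIMSEQ assms)
  ultimately show ?thesis by (simp only: diff_self)
qed

lemma prob_orbit_tail:
  assumes "summable (\<lambda>l. 1 / real (G l))"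
  shows "measure (measure_pmf (orbit N)) {i. \<exists>l>k. full l (digits i)} \<le> tail k"
  using measure_pmf.prob_exists_le[of "\<lambda>l. 1 / real (G l)" "\<lambda>l i. full l (digits i)" "orbit N" k] assms prob_orbit_full_le
  unfolding tail_def by simp

section \<open>Measures with prescribed digit laws\<close>

lemma measurable_digit [measurable]: "(\<lambda>s. s i) \<in> borel \<rightarrow>\<^sub>M count_space (UNIV :: nat set)"
  for i :: nat
proof -
  have "(\<lambda>s. s i) \<in> borel_measurable (borel :: (nat \<Rightarrow> nat) measure)"
    by (rule measurable_product_then_coordinatewise) simp
  then show ?thesis
    using measurable_cong_sets[OF refl sets_borel_eq_count_space] by blast
qed

lemma measurable_low [measurable]: "low m \<in> borel \<rightarrow>\<^sub>M count_space UNIV"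
proof (induction m)
  case (Suc m)
  have [measurable]: "low m \<in> borel \<rightarrow>\<^sub>M count_space UNIV" by fact
  have "(\<lambda>s. low m s + s m * G m) \<in> borel \<rightarrow>\<^sub>M count_space UNIV"
    by (rule measurable_compose_countable[where g = "\<lambda>s. s m"],
        rule measurable_compose_countable[where g = "low m"]) simp_all
  then show ?case by (simp cong: measurable_cong)
qed (simp add: low_def[abs_def])

lemma measurable_full [measurable]: "Measurable.pred borel (full l)"
proof -
  have "{s. full l s} = low l -` {v. Suc v = G l} \<inter> space borel" by (auto simp: full_def)
  then have "{s. full l s} \<in> sets borel" by (simp add: measurable_sets)
  then show ?thesis by (simp add: pred_def)
qed

lemma measurable_advance [measurable]: "advance \<in> borel_measurable borel"
proof (rule measurable_coordinatewise_then_product)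
  fix i
  have "(\<lambda>s. advance s i) \<in> borel \<rightarrow>\<^sub>M count_space UNIV"
    unfolding advance_def by measurable
  then show "(\<lambda>s. advance s i) \<in> borel_measurable borel"
    using measurable_cong_sets[OF refl sets_borel_eq_count_space] by blast
qed

lemma sets_admissible [measurable]: "admissible \<in> sets borel"
proof -
  have "admissible = (\<Inter>m. low m -` {..<G m} \<inter> space borel)" by (auto simp: admissible_def)
  also have "\<dots> \<in> sets borel"
    by (intro sets.countable_INT) (auto simp del: Int_UNIV_right space_borel)
  finally show ?thesis .
qed

text \<open>
  Kolmogorov's extension theorem for the inverse system of the sets \<open>{..<G m}\<close> with the maps that
  forget the highest digit. The extension theorem is stated over complete metric spaces, so it is
  applied to real sequences with integral entries, and the floor function carries the resulting
  measure back to words of natural numbers.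
\<close>

lemma exists_measure_with_laws:
  assumes supp: "\<And>m. set_pmf (q m) \<subseteq> {..<G m}"
    and cons: "\<And>l m. l \<le> m \<Longrightarrow> map_pmf (\<lambda>v. low l (digits v)) (q m) = q l"
  obtains \<mu> :: "(nat \<Rightarrow> nat) measure" where "sets \<mu> = sets borel" "prob_space \<mu>"
    "\<And>m A. measure \<mu> {s. low m s \<in> A} = measure (measure_pmf (q m)) A"
proof -
  \<comment> \<open>The coordinates in \<open>J\<close> are visible from \<open>low m\<close> as soon as \<open>J \<subseteq> {..<m}\<close>; \<open>b J\<close> is the least such \<open>m\<close>.\<close>
  define b where "b J = (if J = {} then 0 else Suc (Max J))" for J :: "nat set"
  define X where "X J v = restrict (\<lambda>i. real (digits v i)) J" for J v
  let ?R = "\<lambda>J. PiM J (\<lambda>_. borel :: real measure)"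
  define P where "P J = distr (measure_pmf (q (b J))) (?R J) (X J)" for J
  have X [measurable]: "X J \<in> measure_pmf r \<rightarrow>\<^sub>M ?R J" for J and r :: "nat pmf"
    by (auto simp: X_def measurable_def space_PiM)
  have P_eq: "P J = distr (measure_pmf (q m)) (?R J) (X J)" if "finite J" "J \<subseteq> {..<m}" for J m
  proof -
    have bm: "b J \<le> m" using that by (auto simp: b_def Suc_le_eq)
    have "i < b J" if "i \<in> J" for i
      using that \<open>finite J\<close> Max_ge[of J i] by (auto simp: b_def less_Suc_eq_le)
    then have same: "X J (low (b J) (digits v)) = X J v" for v
      unfolding X_def using truncate_eq_digits[OF digits_admissible, of "b J" v]
      by (auto simp: restrict_def fun_eq_iff truncate_def) metis
    have "P J = distr (measure_pmf (map_pmf (\<lambda>v. low (b J) (digits v)) (q m))) (?R J) (X J)"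
      unfolding P_def cons[OF bm] ..
    also have "\<dots> = distr (distr (measure_pmf (q m)) (count_space UNIV) (\<lambda>v. low (b J) (digits v))) (?R J) (X J)"
      by (simp add: map_pmf_rep_eq)
    also have "\<dots> = distr (measure_pmf (q m)) (?R J) (X J \<circ> (\<lambda>v. low (b J) (digits v)))"
      by (rule distr_distr) (auto simp: X_def measurable_def space_PiM)
    also have "X J \<circ> (\<lambda>v. low (b J) (digits v)) = X J"
      using same by (simp add: fun_eq_iff)
    finally show ?thesis .
  qed
  have sub: "J \<subseteq> {..<b J}" if "finite J" for J
    using that by (auto simp: b_def less_Suc_eq_le)
  interpret polish_projective "UNIV :: nat set" P
  proof (intro polish_projective.intro projective_family.intro)
    fix J H :: "nat set" assume JH: "J \<subseteq> H" "finite H"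
    have "distr (P H) (?R J) (\<lambda>f. restrict f J) = distr (measure_pmf (q (b H))) (?R J) ((\<lambda>f. restrict f J) \<circ> X H)"
      unfolding P_def using JH by (intro distr_distr measurable_restrict_subset X)
    also have "(\<lambda>f. restrict f J) \<circ> X H = X J"
      using JH by (auto simp: X_def restrict_def fun_eq_iff)
    also have "distr (measure_pmf (q (b H))) (?R J) (X J) = P J"
      using JH sub[of H] by (intro P_eq[symmetric]) (auto intro: finite_subset)
    finally show "P J = distr (P H) (?R J) (\<lambda>f. restrict f J)" ..
  next
    fix J :: "nat set" assume "finite J"
    show "prob_space (P J)"
      unfolding P_def by (intro measure_pmf.prob_space_distr X)
  qed
  let ?Y = "\<lambda>x i. nat \<lfloor>x i :: real\<rfloor>"
  have Y: "?Y \<in> lim \<rightarrow>\<^sub>M borel"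
  proof (rule measurable_coordinatewise_then_product)
    fix i :: nat
    have [measurable]: "(\<lambda>x. x i) \<in> borel_measurable lim"
      by (subst measurable_cong_sets[OF sets_lim refl]) simp
    have "(\<lambda>x. nat \<lfloor>x i\<rfloor>) \<in> lim \<rightarrow>\<^sub>M count_space UNIV"
      by measurable
    then show "(\<lambda>x. nat \<lfloor>x i\<rfloor>) \<in> borel_measurable lim"
      using measurable_cong_sets[OF refl sets_borel_eq_count_space] by blast
  qed
  define \<mu> where "\<mu> = distr lim borel ?Y"
  have "measure \<mu> {s. low m s \<in> A} = measure (measure_pmf (q m)) A" for m A
  proof -
    let ?J = "{..<m}"
    let ?S = "{f \<in> space (?R ?J). low m (?Y f) \<in> A}"
    \<comment> \<open>Only coordinates below \<open>m\<close> are measurable on the finite product; padding with zeros does not change \<open>low m\<close>.\<close>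
    have "(\<lambda>f. ?Y (\<lambda>i. if i < m then f i else 0)) \<in> ?R ?J \<rightarrow>\<^sub>M borel"
    proof (rule measurable_coordinatewise_then_product)
      fix i :: nat
      have "(\<lambda>f. nat \<lfloor>if i < m then f i else 0 :: real\<rfloor>) \<in> ?R ?J \<rightarrow>\<^sub>M count_space UNIV"
        by (cases "i < m") simp_all
      then show "(\<lambda>f. nat \<lfloor>if i < m then f i else 0 :: real\<rfloor>) \<in> borel_measurable (?R ?J)"
        using measurable_cong_sets[OF refl sets_borel_eq_count_space] by blast
    qed
    then have "(\<lambda>f. low m (?Y (\<lambda>i. if i < m then f i else 0))) \<in> ?R ?J \<rightarrow>\<^sub>M count_space UNIV"
      by (rule measurable_compose) simp
    moreover have "low m (?Y (\<lambda>i. if i < m then f i else 0)) = low m (?Y f)" for f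
      by (rule low_cong) simp
    ultimately have "(\<lambda>f. low m (?Y f)) \<in> ?R ?J \<rightarrow>\<^sub>M count_space UNIV" by simp
    then have S: "?S \<in> sets (?R ?J)"
      using measurable_sets[of "\<lambda>f. low m (?Y f)" "?R ?J" "count_space UNIV" A]
      by (simp add: vimage_def Int_def conj_commute)
    have "{s. low m s \<in> A} \<in> sets borel"
      using measurable_sets[OF measurable_low, of A m] by (simp add: vimage_def)
    then have "measure \<mu> {s. low m s \<in> A} = measure lim {x. low m (?Y x) \<in> A}"
      unfolding \<mu>_def by (subst measure_distr[OF Y]) (auto simp: vimage_def space_PiM)
    also have "{x. low m (?Y x) \<in> A} = emb UNIV ?J ?S"
    proof -
      have "low m (?Y (restrict x ?J)) = low m (?Y x)" for x by (rule low_cong) simp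
      then show ?thesis by (auto simp: prod_emb_def space_PiM)
    qed
    also have "measure lim \<dots> = measure (P ?J) ?S"
      using S by (intro measure_lim_emb) auto
    also have "\<dots> = measure (measure_pmf (q m)) (X ?J -` ?S)"
      using measure_distr[OF X[of ?J "q m"] S] P_eq[of ?J m] by simp
    also have "\<dots> = measure (measure_pmf (q m)) A"
    proof (rule measure_pmf.finite_measure_eq_AE)
      have "low m (?Y (X ?J v)) = v" if "v < G m" for v
      proof -
        have "low m (?Y (X ?J v)) = low m (digits v)" by (rule low_cong) (simp add: X_def)
        then show ?thesis using low_digits[OF that] by simp
      qed
      then show "AE v in measure_pmf (q m). v \<in> X ?J -` ?S \<longleftrightarrow> v \<in> A"
        using supp[of m] by (auto simp: AE_measure_pmf_iff X_def space_PiM)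
    qed auto
    finally show ?thesis .
  qed
  moreover have "prob_space \<mu>" unfolding \<mu>_def by (rule P.prob_space_distr[OF Y])
  moreover have "sets \<mu> = sets borel" by (simp add: \<mu>_def)
  ultimately show thesis using that by blast
qed

section \<open>Digit frequencies converge\<close>

lemma low_in_sets: "sets \<mu> = sets borel \<Longrightarrow> {s. low m s \<in> A} \<in> sets \<mu>"
  using measurable_sets[OF measurable_low, of A m] by (simp add: vimage_def)

lemma AE_admissible:
  assumes sets [measurable_cong]: "sets \<mu> = sets borel" and prob: "prob_space \<mu>"
    and laws: "\<And>m A. measure \<mu> {s. low m s \<in> A} = measure (measure_pmf (q m)) A"
    and supp: "\<And>m. set_pmf (q m) \<subseteq> {..<G m}"
  shows "AE s in \<mu>. s \<in> admissible"
proof -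
  interpret prob_space \<mu> by fact
  have space [simp]: "space \<mu> = UNIV" using sets_eq_imp_space_eq[OF sets] by simp
  have "AE s in \<mu>. low m s < G m" for m
  proof -
    have "prob {s. low m s \<in> {..<G m}} = 1"
      unfolding laws using supp[of m] by (subst measure_pmf.prob_eq_1) (auto simp: AE_measure_pmf_iff)
    then show ?thesis using prob_eq_1[OF low_in_sets[OF sets], of m "{..<G m}"] by simp
  qed
  then show ?thesis unfolding admissible_def by (simp add: AE_all_countable)
qed

text \<open>
  Discontinuity of the odometer enters only through carries across arbitrarily high levels. Fix \<open>k\<close>.
  If no level above \<open>k\<close> is full, \<open>low m (advance s)\<close> is a function of \<open>low k s\<close>; the exceptional
  event has probability at most \<open>tail k\<close> under \<open>\<mu>\<close> and under every empirical measure. Comparing both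
  sides through the event \<open>E\<close> on \<open>low k s\<close> gives
  \<open>\<mu> {s. low m (advance s) \<in> V} \<le> \<mu> {s. low m s \<in> V} + 2 * tail k\<close>, and \<open>k \<longlongrightarrow> \<infinity>\<close> removes
  the error. The reverse inequality is the same one for the complement of \<open>V\<close>.
\<close>

lemma invariant_limit_measure:
  assumes sets [measurable_cong]: "sets \<mu> = sets borel" and prob: "prob_space \<mu>"
    and laws: "\<And>m A. measure \<mu> {s. low m s \<in> A} = measure (measure_pmf (q m)) A"
    and supp: "\<And>m. set_pmf (q m) \<subseteq> {..<G m}"
    and lim: "\<And>m A. (\<lambda>n. measure (measure_pmf (orbit_law (r n) m)) A) \<longlonglongrightarrow> measure (measure_pmf (q m)) A"
    and r: "strict_mono r"
    and summable: "summable (\<lambda>l. 1 / real (G l))"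
  shows "distr \<mu> borel advance = \<mu>"
proof -
  interpret prob_space \<mu> by fact
  have space [simp]: "space \<mu> = UNIV" using sets_eq_imp_space_eq[OF sets] by simp
  note AE_adm = AE_admissible[OF sets prob laws supp]
  have adv [measurable]: "advance \<in> \<mu> \<rightarrow>\<^sub>M borel" by measurable
  have full_le: "prob {s. full l s} \<le> 1 / real (G l)" for l
  proof -
    have "prob {s. full l s} = measure (measure_pmf (q l)) {v. Suc v = G l}"
      unfolding laws[symmetric] by (simp add: full_def)
    also have "\<dots> \<le> 1 / real (G l)"
    proof (rule LIMSEQ_le_const2[OF lim], intro exI allI impI)
      fix n show "measure (measure_pmf (orbit_law (r n) l)) {v. Suc v = G l} \<le> 1 / real (G l)"
        using prob_orbit_full_le[of "r n" l] by (simp add: measure_orbit_law full_def)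
    qed
    finally show ?thesis .
  qed
  have tail_le: "prob {s. \<exists>l>k. full l s} \<le> tail k" for k
    using prob_exists_le[OF summable, of full k] full_le unfolding tail_def by simp
  have le: "prob {s. low m (advance s) \<in> V} \<le> prob {s. low m s \<in> V}" for m V
  proof -
    have bound: "prob {s. low m (advance s) \<in> V} \<le> prob {s. low m s \<in> V} + 2 * tail k" if k: "k \<ge> m" for k
    proof -
      define E where "E = {u. (if \<exists>l\<ge>m. l \<le> k \<and> full l (digits u) then 0 else Suc (low m (digits u))) \<in> V}"
      have E: "low m (advance s) \<in> V \<longleftrightarrow> low k s \<in> E"
        if s: "s \<in> admissible" and nf: "\<not> (\<exists>l>k. full l s)" for s
      proof -
        have "low l (digits (low k s)) = low l s" if "l \<le> k" for l
          using low_low[OF s that] .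
        then have "(\<exists>l\<ge>m. l \<le> k \<and> full l (digits (low k s))) \<longleftrightarrow> (\<exists>l\<ge>m. full l s)"
          using nf by (auto simp: full_def) (metis not_less)
        moreover have "low m (digits (low k s)) = low m s" using low_low[OF s k] .
        ultimately show ?thesis unfolding E_def low_advance mem_Collect_eq by (simp only:)
      qed
      have "prob {s. low m (advance s) \<in> V} \<le> prob ({s. low k s \<in> E} \<union> {s. \<exists>l>k. full l s})"
      proof (rule finite_measure_mono_AE)
        show "AE s in \<mu>. s \<in> {s. low m (advance s) \<in> V} \<longrightarrow> s \<in> {s. low k s \<in> E} \<union> {s. \<exists>l>k. full l s}"
          using AE_adm by eventually_elim (use E in blast)
        have "{s \<in> space \<mu>. low k s \<in> E \<or> (\<exists>l>k. full l s)} \<in> events" by measurable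
        then show "{s. low k s \<in> E} \<union> {s. \<exists>l>k. full l s} \<in> events"
          by (simp add: Un_def)
      qed
      also have "\<dots> \<le> prob {s. low k s \<in> E} + prob {s. \<exists>l>k. full l s}"
      proof (rule measure_Un_le)
        have "{s \<in> space \<mu>. low k s \<in> E} \<in> events" "{s \<in> space \<mu>. \<exists>l>k. full l s} \<in> events" by measurable
        then show "{s. low k s \<in> E} \<in> events" "{s. \<exists>l>k. full l s} \<in> events" by simp_all
      qed
      also have "\<dots> \<le> measure (measure_pmf (q k)) E + tail k"
        using tail_le[of k] by (simp add: laws)
      finally have 1: "prob {s. low m (advance s) \<in> V} \<le> measure (measure_pmf (q k)) E + tail k" .
      have "measure (measure_pmf (q k)) E \<le> measure (measure_pmf (q m)) V + 0 + tail k"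
      proof (rule LIMSEQ_le[OF lim])
        have "(\<lambda>n. 1 / real (Suc (r n))) \<longlonglongrightarrow> 0"
          using LIMSEQ_subseq_LIMSEQ[OF LIMSEQ_Suc[OF lim_1_over_n] r] by (simp add: o_def)
        then show "(\<lambda>n. measure (measure_pmf (orbit_law (r n) m)) V + 1 / real (Suc (r n)) + tail k)
          \<longlonglongrightarrow> measure (measure_pmf (q m)) V + 0 + tail k"
          by (intro tendsto_add lim tendsto_const)
        have "measure (measure_pmf (orbit_law N k)) E
            \<le> measure (measure_pmf (orbit_law N m)) V + 1 / real (Suc N) + tail k" for N
        proof -
          have "measure (measure_pmf (orbit_law N k)) E = measure (measure_pmf (orbit N)) {i. low k (digits i) \<in> E}"
            by (rule measure_orbit_law)
          also have "\<dots> \<le> measure (measure_pmf (orbit N)) ({i. low m (digits (Suc i)) \<in> V} \<union> {i. \<exists>l>k. full l (digits i)})"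
            using E[OF digits_admissible]
            by (intro measure_pmf.finite_measure_mono) (auto simp: advance_digits)
          also have "\<dots> \<le> measure (measure_pmf (orbit N)) {i. low m (digits (Suc i)) \<in> V} +
             measure (measure_pmf (orbit N)) {i. \<exists>l>k. full l (digits i)}"
            by (rule measure_Un_le) auto
          also have "\<dots> \<le> (measure (measure_pmf (orbit N)) {i. low m (digits i) \<in> V} + 1 / real (Suc N)) + tail k"
            by (intro add_mono prob_orbit_shift prob_orbit_tail summable)
          finally show ?thesis by (simp add: measure_orbit_law)
        qed
        then show "\<exists>N. \<forall>n\<ge>N. measure (measure_pmf (orbit_law (r n) k)) E
            \<le> measure (measure_pmf (orbit_law (r n) m)) V + 1 / real (Suc (r n)) + tail k"
          by blast
      qed
      with 1 show ?thesis by (simp add: laws)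
    qed
    have "(\<lambda>k. prob {s. low m s \<in> V} + 2 * tail k) \<longlonglongrightarrow> prob {s. low m s \<in> V} + 2 * 0"
      by (intro tendsto_intros tail_tendsto_0 summable)
    then show ?thesis
      using bound by (intro LIMSEQ_le_const[of "\<lambda>k. prob {s. low m s \<in> V} + 2 * tail k"]) auto
  qed
  have eq: "prob {s. low m (advance s) \<in> V} = prob {s. low m s \<in> V}" for m V
  proof -
    have "{s \<in> space \<mu>. low m (advance s) \<in> V} \<in> events" "{s \<in> space \<mu>. low m s \<in> V} \<in> events" by measurable
    then have "{s. low m (advance s) \<in> V} \<in> events" "{s. low m s \<in> V} \<in> events" by simp_all
    then have "prob (space \<mu> - {s. low m (advance s) \<in> V}) = 1 - prob {s. low m (advance s) \<in> V}"
      "prob (space \<mu> - {s. low m s \<in> V}) = 1 - prob {s. low m s \<in> V}"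
      by (simp_all only: prob_compl)
    moreover have "space \<mu> - {s. low m (advance s) \<in> V} = {s. low m (advance s) \<in> - V}"
      "space \<mu> - {s. low m s \<in> V} = {s. low m s \<in> - V}" by auto
    ultimately show ?thesis using le[of m V] le[of m "- V"] by simp
  qed
  have sets_PiM: "sets (PiM UNIV (\<lambda>_::nat. borel :: nat measure)) = sets borel"
    by (rule sets_PiM_equal_borel)
  have "\<mu> = distr \<mu> borel advance"
  proof (rule measure_eqI_PiM_infinite)
    show "sets \<mu> = sets (PiM UNIV (\<lambda>_::nat. borel :: nat measure))"
      "sets (distr \<mu> borel advance) = sets (PiM UNIV (\<lambda>_::nat. borel :: nat measure))"
      by (simp_all add: sets sets_PiM)
    show "finite_measure \<mu>" by unfold_locales
  next
    fix A and J :: "nat set" assume J: "finite J" and A: "\<And>i. i \<in> J \<Longrightarrow> A i \<in> sets (borel :: nat measure)"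
    let ?C = "prod_emb UNIV (\<lambda>_. borel :: nat measure) J (PiE J A)"
    have C_sets: "?C \<in> sets borel"
      unfolding sets_PiM[symmetric] using J A by (intro sets_PiM_I) auto
    obtain m where m: "J \<subseteq> {..<m}" using J by (metis finite_nat_iff_bounded)
    define V where "V = {v. \<forall>i\<in>J. digits v i \<in> A i}"
    have C: "s \<in> ?C \<longleftrightarrow> low m s \<in> V" if "s \<in> admissible" for s
    proof -
      have "digits (low m s) i = s i" if "i \<in> J" for i
        using m that truncate_eq_digits[OF \<open>s \<in> admissible\<close>, of m, symmetric] by (auto simp: truncate_def)
      then show ?thesis by (auto simp: prod_emb_def V_def PiE_iff)
    qed
    have ev: "{s \<in> space \<mu>. low m (advance s) \<in> V} \<in> events" "{s \<in> space \<mu>. low m s \<in> V} \<in> events" by measurable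
    have "prob ?C = prob {s. low m s \<in> V}"
    proof (rule finite_measure_eq_AE)
      show "AE s in \<mu>. s \<in> ?C \<longleftrightarrow> s \<in> {s. low m s \<in> V}"
        using AE_adm by eventually_elim (use C in blast)
    qed (use C_sets ev sets in auto)
    also have "\<dots> = prob {s. low m (advance s) \<in> V}" by (rule eq[symmetric])
    also have "\<dots> = prob (advance -` ?C \<inter> space \<mu>)"
    proof (rule finite_measure_eq_AE)
      show "AE s in \<mu>. s \<in> {s. low m (advance s) \<in> V} \<longleftrightarrow> s \<in> advance -` ?C \<inter> space \<mu>"
        using AE_adm by eventually_elim (use C advance_admissible in auto)
    qed (use C_sets ev measurable_sets[OF adv] in auto)
    finally show "emeasure \<mu> ?C = emeasure (distr \<mu> borel advance) ?C"
      using C_sets by (simp add: emeasure_distr emeasure_eq_measure)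
  qed
  then show ?thesis ..
qed

text \<open>
  The measure is constructed on all words; since it is concentrated on \<open>admissible\<close>, its restriction
  is an invariant measure in the sense of unique ergodicity.
\<close>

lemma invariant_borel_prob_restrict:
  assumes sets: "sets \<mu> = sets borel" and prob: "prob_space \<mu>"
    and AE: "AE s in \<mu>. s \<in> admissible"
    and inv: "distr \<mu> borel advance = \<mu>"
  shows "invariant_borel_prob admissible (odometer G) (restrict_space \<mu> admissible)"
proof -
  interpret prob_space \<mu> by fact
  let ?\<nu> = "restrict_space \<mu> admissible"
  have space [simp]: "space \<mu> = UNIV" using sets_eq_imp_space_eq[OF sets] by simp
  have adm: "admissible \<in> sets \<mu>" using sets sets_admissible by simp
  have adv: "advance \<in> \<mu> \<rightarrow>\<^sub>M \<mu>"
    using measurable_advance measurable_cong_sets[OF sets sets] by blast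
  have meas: "odometer G \<in> ?\<nu> \<rightarrow>\<^sub>M ?\<nu>"
  proof -
    have "advance \<in> ?\<nu> \<rightarrow>\<^sub>M ?\<nu>"
      by (intro measurable_restrict_space2 measurable_restrict_space1 adv)
         (auto simp: space_restrict_space advance_admissible)
    then show ?thesis
      by (rule measurable_cong[THEN iffD1, rotated]) (simp add: space_restrict_space odometer_eq_advance)
  qed
  have "distr ?\<nu> ?\<nu> (odometer G) = ?\<nu>"
  proof (rule measure_eqI)
    fix B assume "B \<in> sets (distr ?\<nu> ?\<nu> (odometer G))"
    then have B: "B \<in> sets ?\<nu>" by simp
    then have B': "B \<in> sets \<mu>" "B \<subseteq> admissible" using adm by (auto simp: sets_restrict_space_iff)
    have "emeasure (distr ?\<nu> ?\<nu> (odometer G)) B = emeasure ?\<nu> (odometer G -` B \<inter> admissible)"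
      using B meas by (simp add: emeasure_distr space_restrict_space)
    also have "odometer G -` B \<inter> admissible = advance -` B \<inter> admissible"
      by (auto simp: odometer_eq_advance)
    also have "emeasure ?\<nu> \<dots> = emeasure \<mu> (advance -` B \<inter> admissible)"
      using adm by (intro emeasure_restrict_space) auto
    also have "\<dots> = emeasure \<mu> (advance -` B \<inter> space \<mu>)"
    proof (rule emeasure_eq_AE)
      show "AE s in \<mu>. s \<in> advance -` B \<inter> admissible \<longleftrightarrow> s \<in> advance -` B \<inter> space \<mu>"
        using AE by eventually_elim auto
      show "advance -` B \<inter> space \<mu> \<in> sets \<mu>" using adv B'(1) by (rule measurable_sets)
      then show "advance -` B \<inter> admissible \<in> sets \<mu>" using adm by auto
    qed
    also have "\<dots> = emeasure (distr \<mu> \<mu> advance) B" using adv B' by (simp add: emeasure_distr)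
    also have "distr \<mu> \<mu> advance = \<mu>" using inv distr_cong[OF refl sets, of \<mu> advance advance] by simp
    also have "emeasure \<mu> B = emeasure ?\<nu> B" using adm B' by (simp add: emeasure_restrict_space)
    finally show "emeasure (distr ?\<nu> ?\<nu> (odometer G)) B = emeasure ?\<nu> B" .
  qed simp
  moreover have "prob_space ?\<nu>"
  proof
    have "emeasure \<mu> admissible = emeasure \<mu> (space \<mu>)"
      by (rule emeasure_eq_AE) (use AE adm in \<open>auto simp del: space\<close>)
    then show "emeasure ?\<nu> (space ?\<nu>) = 1"
      using adm by (simp add: space_restrict_space emeasure_restrict_space emeasure_space_1[simplified])
  qed
  moreover have "sets ?\<nu> = sets (restrict_space borel admissible)"
    by (rule sets_restrict_space_cong[OF sets])
  ultimately show ?thesis using meas unfolding invariant_borel_prob_def by blast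
qed

text \<open>
  The limit must be the mass that the unique invariant measure gives to the pattern, because every
  sequence of times has a subsequence along which the empirical measures converge on all patterns to
  some invariant measure.
\<close>

lemma orbit_law_tendsto:
  assumes ue: "uniquely_ergodic admissible (odometer G)"
    and summable: "summable (\<lambda>l. 1 / real (G l))"
  shows "\<exists>L. (\<lambda>N. measure (measure_pmf (orbit_law N m)) A) \<longlonglongrightarrow> L"
proof -
  obtain \<nu> where unique: "\<And>\<mu>. invariant_borel_prob admissible (odometer G) \<mu> \<Longrightarrow> \<mu> = \<nu>"
    using ue unfolding uniquely_ergodic_def by blast
  have "(\<lambda>N. measure (measure_pmf (orbit_law N m)) A) \<longlonglongrightarrow> measure \<nu> ({s. low m s \<in> A} \<inter> admissible)"
  proof (rule tendsto_if_subsequences_tendsto)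
    fix r :: "nat \<Rightarrow> nat" assume r: "strict_mono r"
    obtain s p where s: "strict_mono s"
      and p: "\<And>x. (\<lambda>n. (\<lambda>(m, v). pmf (orbit_law (r (s n)) m) v) x) \<longlonglongrightarrow> p x"
      by (rule pointwise_convergent_subsequence[of "\<lambda>n (m, v). pmf (orbit_law (r n) m) v"])
         (auto simp: pmf_nonneg pmf_le_1)
    have "\<exists>q. set_pmf q \<subseteq> {..<G m} \<and>
        (\<forall>A. (\<lambda>n. measure (measure_pmf (orbit_law (r (s n)) m)) A) \<longlonglongrightarrow> measure (measure_pmf q) A)" for m
    proof -
      have "(\<lambda>n. pmf (orbit_law (r (s n)) m) v) \<longlonglongrightarrow> p (m, v)" for v
        using p[of "(m, v)"] by simp
      then obtain q where "set_pmf q \<subseteq> {..<G m}"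
        "\<And>A. (\<lambda>n. measure (measure_pmf (orbit_law (r (s n)) m)) A) \<longlonglongrightarrow> measure (measure_pmf q) A"
        using pmf_tendsto_measure[OF set_orbit_law, of "\<lambda>n. r (s n)" m "\<lambda>v. p (m, v)"] by blast
      then show ?thesis by blast
    qed
    then obtain q where supp: "\<And>m. set_pmf (q m) \<subseteq> {..<G m}"
      and lim: "\<And>m A. (\<lambda>n. measure (measure_pmf (orbit_law (r (s n)) m)) A) \<longlonglongrightarrow> measure (measure_pmf (q m)) A"
      by metis
    have cons: "map_pmf (\<lambda>v. low l (digits v)) (q m) = q l" if "l \<le> m" for l m
    proof (rule pmf_eqI)
      fix x
      have "map_pmf (\<lambda>v. low l (digits v)) (orbit_law N m) = orbit_law N l" for N
        using that by (simp add: orbit_law_def pmf.map_comp o_def low_low digits_admissible)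
      then have "measure (measure_pmf (orbit_law N m)) ((\<lambda>v. low l (digits v)) -` {x}) = measure (measure_pmf (orbit_law N l)) {x}" for N
        by (metis measure_map_pmf)
      then have "measure (measure_pmf (q m)) ((\<lambda>v. low l (digits v)) -` {x}) = measure (measure_pmf (q l)) {x}"
        using LIMSEQ_unique[OF lim[of m "(\<lambda>v. low l (digits v)) -` {x}"]] lim[of l "{x}"] by simp
      then show "pmf (map_pmf (\<lambda>v. low l (digits v)) (q m)) x = pmf (q l) x"
        by (simp add: pmf_map measure_pmf_single)
    qed
    obtain \<mu> :: "(nat \<Rightarrow> nat) measure" where \<mu>: "sets \<mu> = sets borel" "prob_space \<mu>"
      "\<And>m A. measure \<mu> {s. low m s \<in> A} = measure (measure_pmf (q m)) A"
      using exists_measure_with_laws[OF supp cons] by blast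
    interpret prob_space \<mu> by fact
    have space [simp]: "space \<mu> = UNIV" using sets_eq_imp_space_eq[OF \<mu>(1)] by simp
    have AE: "AE s in \<mu>. s \<in> admissible" by (rule AE_admissible[OF \<mu> supp])
    have "strict_mono (\<lambda>n. r (s n))" using r s by (simp add: strict_mono_def)
    then have "distr \<mu> borel advance = \<mu>"
      by (rule invariant_limit_measure[OF \<mu> supp lim _ summable])
    then have \<nu>: "restrict_space \<mu> admissible = \<nu>"
      by (intro unique invariant_borel_prob_restrict \<mu> AE)
    have adm: "admissible \<in> sets \<mu>" using \<mu>(1) sets_admissible by simp
    have ev: "{s. low m s \<in> A} \<in> sets \<mu>" by (rule low_in_sets[OF \<mu>(1)])
    have "measure \<nu> ({s. low m s \<in> A} \<inter> admissible) = measure \<mu> ({s. low m s \<in> A} \<inter> admissible)"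
      unfolding \<nu>[symmetric] using adm by (intro measure_restrict_space) auto
    also have "\<dots> = measure \<mu> {s. low m s \<in> A}"
      by (rule finite_measure_eq_AE) (use AE adm ev in auto)
    finally show "\<exists>s. strict_mono s \<and> (\<lambda>n. measure (measure_pmf (orbit_law (r (s n)) m)) A)
        \<longlonglongrightarrow> measure \<nu> ({s. low m s \<in> A} \<inter> admissible)"
      using lim[of m A] s \<mu>(3) by auto
  qed
  then show ?thesis by blast
qed

section \<open>The mean carry\<close>

text \<open>
  The carry gained by taking level \<open>Suc k\<close> into account; summed over \<open>k\<close> it telescopes to the highest
  full level.
\<close>

definition carry_gain :: "nat \<Rightarrow> (nat \<Rightarrow> nat) \<Rightarrow> real" where
  "carry_gain k s = real (highest_full (Suc k) s) - real (highest_full k s)"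

lemma carry_gain_bounds: "0 \<le> carry_gain k s" "carry_gain k s \<le> real (Suc k) * of_bool (full (Suc k) s)"
  using highest_full_le[of k s] by (auto simp: carry_gain_def)

lemma highest_full_cong:
  assumes "\<And>l. l \<le> k \<Longrightarrow> full l s = full l t"
  shows "highest_full k s = highest_full k t"
  using assms by (induction k) auto

lemma carry_gain_low:
  assumes "s \<in> admissible"
  shows "carry_gain k (digits (low (Suc k) s)) = carry_gain k s"
  unfolding carry_gain_def using low_low[OF assms]
  by (intro arg_cong2[where f = "(-)"] arg_cong[where f = real] highest_full_cong) (simp_all add: full_def del: low_Suc)

definition mean_gain :: "nat \<Rightarrow> nat \<Rightarrow> real" where
  "mean_gain k N = (\<Sum>i<Suc N. carry_gain k (digits i)) / real (Suc N)"

lemma mean_gain_convergent: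
  assumes "uniquely_ergodic admissible (odometer G)" "summable (\<lambda>l. 1 / real (G l))"
  shows "\<exists>L. mean_gain k \<longlonglongrightarrow> L"
proof -
  let ?m = "Suc k"
  have "\<exists>L. (\<lambda>N. pmf (orbit_law N ?m) v) \<longlonglongrightarrow> L" for v
    using orbit_law_tendsto[OF assms, of ?m "{v}"] by (simp add: measure_pmf_single)
  then obtain p where p: "\<And>v. (\<lambda>N. pmf (orbit_law N ?m) v) \<longlonglongrightarrow> p v" by metis
  have "mean_gain k N = (\<Sum>v<G ?m. pmf (orbit_law N ?m) v * carry_gain k (digits v))" for N
  proof -
    have "mean_gain k N = measure_pmf.expectation (orbit N) (\<lambda>i. carry_gain k (digits i))"
      unfolding mean_gain_def by (subst integral_pmf_of_set) (auto simp: lessThan_empty_iff)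
    also have "\<dots> = measure_pmf.expectation (orbit_law N ?m) (\<lambda>v. carry_gain k (digits v))"
      by (simp add: orbit_law_def carry_gain_low digits_admissible del: low_Suc)
    also have "\<dots> = (\<Sum>v<G ?m. pmf (orbit_law N ?m) v *\<^sub>R carry_gain k (digits v))"
      using set_orbit_law[of N ?m] by (intro integral_measure_pmf) auto
    finally show ?thesis by simp
  qed
  then have "mean_gain k = (\<lambda>N. \<Sum>v<G ?m. pmf (orbit_law N ?m) v * carry_gain k (digits v))"
    by (rule ext)
  also have "\<dots> \<longlonglongrightarrow> (\<Sum>v<G ?m. p v * carry_gain k (digits v))"
    by (intro tendsto_intros p)
  finally have "mean_gain k \<longlonglongrightarrow> (\<Sum>v<G ?m. p v * carry_gain k (digits v))" .
  then show ?thesis ..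
qed

lemma mean_gain_bound: "norm (mean_gain k N) \<le> real (Suc k) / real (G (Suc k))"
proof -
  have "mean_gain k N \<le> (\<Sum>i<Suc N. real (Suc k) * of_bool (full (Suc k) (digits i))) / real (Suc N)"
    unfolding mean_gain_def by (intro divide_right_mono sum_mono carry_gain_bounds) auto
  also have "\<dots> = real (Suc k) * measure (measure_pmf (orbit N)) {i. full (Suc k) (digits i)}"
    unfolding prob_orbit sum_distrib_left[symmetric] by (simp add: sum_of_bool_eq Int_def del: of_nat_Suc sum.lessThan_Suc)
  also have "\<dots> \<le> real (Suc k) * (1 / real (G (Suc k)))"
    by (intro mult_left_mono prob_orbit_full_le) auto
  finally have "mean_gain k N \<le> real (Suc k) / real (G (Suc k))" by simp
  moreover have "0 \<le> mean_gain k N"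
    unfolding mean_gain_def by (intro divide_nonneg_nonneg sum_nonneg carry_gain_bounds) auto
  ultimately show ?thesis by simp
qed

lemma carry_gain_sums: "(\<lambda>k. carry_gain k (digits i)) sums real (highest_full (Suc i) (digits i))"
proof -
  have "highest_full k (digits i) = highest_full (Suc i) (digits i)" if "k \<ge> Suc i" for k
    using that
  proof (induction rule: dec_induct)
    case (step k)
    have "Suc i < G (Suc k)" using less_G[of "Suc k"] step by simp
    then show ?case using step not_full_digits[of i "Suc k"] by simp
  qed simp
  then have "(\<lambda>k. real (highest_full k (digits i))) \<longlonglongrightarrow> real (highest_full (Suc i) (digits i))"
    by (intro tendsto_eventually eventually_sequentiallyI[of "Suc i"]) simp
  from telescope_sums[OF this] show ?thesis by (simp only: carry_gain_def highest_full.simps(1) of_nat_0 diff_0_right)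
qed

text \<open>
  Tannery's theorem exchanges the limit in the number of integers with the sum over the levels. Its
  dominating series is the hypothesis on \<open>G\<close>: level \<open>k\<close> gains at most \<open>k\<close>, with frequency at most
  \<open>1 / G k\<close>.
\<close>

lemma mean_highest_full_convergent:
  assumes "uniquely_ergodic admissible (odometer G)" "summable (\<lambda>k. real k / real (G k))"
  shows "\<exists>L. (\<lambda>N. (\<Sum>i<Suc N. real (highest_full (Suc i) (digits i))) / real (Suc N)) \<longlonglongrightarrow> L"
proof -
  have "summable (\<lambda>l. 1 / real (G l))"
    by (rule summable_comparison_test'[OF assms(2), of 1]) (auto simp: divide_right_mono)
  then obtain b where b: "\<And>k. mean_gain k \<longlonglongrightarrow> b k"
    using mean_gain_convergent[OF assms(1)] by metis
  have "(\<lambda>N. \<Sum>k. mean_gain k N) \<longlonglongrightarrow> suminf b"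
  proof (rule tannerys_theorem[THEN conjunct2, THEN conjunct2])
    show "summable (\<lambda>k. real (Suc k) / real (G (Suc k)))"
      using assms(2) by (subst summable_Suc_iff)
    show "\<forall>\<^sub>F (k, N) in sequentially \<times>\<^sub>F sequentially. norm (mean_gain k N) \<le> real (Suc k) / real (G (Suc k))"
      using mean_gain_bound by (intro always_eventually) auto
  qed (use b in auto)
  moreover have "(\<Sum>k. mean_gain k N) = (\<Sum>i<Suc N. real (highest_full (Suc i) (digits i))) / real (Suc N)" for N
    unfolding mean_gain_def by (intro sums_unique[symmetric] sums_divide sums_sum carry_gain_sums)
  ultimately show ?thesis by auto
qed

end

theorem theorem5p17:
  fixes G :: "nat \<Rightarrow> nat"
  assumes "greedy_basis G"
    and "uniquely_ergodic (compactification G) (odometer G)"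
    and "summable (\<lambda>k. real k / real (G k))"
  shows "\<exists>c::real.
    (\<lambda>N. (\<Sum>i<N. ereal_of_enat (cp G ((odometer G ^^ i) (\<lambda>_. 0)))) / ereal (real N))
      \<longlonglongrightarrow> ereal c"
proof -
  interpret greedy_numeration G
    using assms(1) unfolding greedy_basis_def greedy_numeration_def by blast
  obtain L where L: "(\<lambda>N. (\<Sum>i<Suc N. real (highest_full (Suc i) (digits i))) / real (Suc N)) \<longlonglongrightarrow> L"
    using mean_highest_full_convergent[OF assms(2)[unfolded compactification_eq] assms(3)] by blast
  have mean: "(\<Sum>i<Suc N. ereal_of_enat (cp G ((odometer G ^^ i) (\<lambda>_. 0)))) / ereal (real (Suc N))
      = ereal (1 + (\<Sum>i<Suc N. real (highest_full (Suc i) (digits i))) / real (Suc N))" for N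
  proof -
    have "(\<Sum>i<Suc N. ereal_of_enat (cp G ((odometer G ^^ i) (\<lambda>_. 0))))
        = (\<Sum>i<Suc N. ereal (1 + real (highest_full (Suc i) (digits i))))"
      unfolding odometer_funpow_0 by (intro sum.cong refl) (simp only: cp_digits[OF lessI] ereal_of_enat_simps of_nat_Suc)
    also have "\<dots> = ereal (real (Suc N) + (\<Sum>i<Suc N. real (highest_full (Suc i) (digits i))))"
      unfolding sum_ereal sum.distrib by simp
    finally show ?thesis by (simp add: add_divide_distrib del: sum.lessThan_Suc of_nat_Suc)
  qed
  have "(\<lambda>N. (\<Sum>i<Suc N. ereal_of_enat (cp G ((odometer G ^^ i) (\<lambda>_. 0)))) / ereal (real (Suc N)))
      \<longlonglongrightarrow> ereal (1 + L)"
    unfolding mean by (intro tendsto_intros L)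
  then have "(\<lambda>N. (\<Sum>i<N. ereal_of_enat (cp G ((odometer G ^^ i) (\<lambda>_. 0)))) / ereal (real N)) \<longlonglongrightarrow> ereal (1 + L)"
    by (rule LIMSEQ_imp_Suc)
  then show ?thesis ..
qed

end
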